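(* Let $m$ and $r$ be integers with $m \ge r \ge 3$. Let $G$ be an $r$-regular graph of even order with $\lambda_{oc}(G) \ge (2m-1)(r-1)$, and let $M$ be a distance $3$ matching in $G$ with $|M| = m$. If there exist $mr-r+1$ edge-disjoint odd ears of $V(M)$ in $G$, then $M$ extends to a perfect matching of $G$.
   Context: All graphs are finite and simple. $V(M)$ is the set of endvertices of the edges of $M$. A set $F$ of edges of a graph $G$ is a cyclic edge cut if $G-F$ has two components each of which contains a cycle. $F$ is an odd-cyclic edge cut if $F$ is a cyclic edge cut such that a component of $G-F$ contains a cycle of odd length. $\lambda_{oc}(G)$ denotes the size of a minimum odd-cyclic edge cut of $G$; if $G$ has no odd-cyclic edge cut, $\lambda_{oc}(G)=\infty$. The distance between two edges $e,f$ is the length of a shortest path joining an endvertex of $e$ and an endvertex of $f$. A matching $M$ is a distance $d$ matching if the distance between each pair of distinct edges of $M$ is at least $d$. For $U \subseteq V(G)$, an ear of $U$ is either a path having both endvertices but no internal vertices in $U$, or a cycle having exactly one vertex in $U$ (in particular, every edge joining two vertices of $U$ is an ear of $U$). An ear is odd if it contains an odd number of edges. A matching $M$ of $G$ extends to a perfect matching if there is a perfect matching $M^*$ of $G$ with $M \subseteq M^*$. *)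

theory Defs
  imports Main "HOL-Library.Extended_Nat"
begin

text \<open>
  A graph is given by its vertex set \<open>V\<close> and its set \<open>E\<close> of edges, an edge being the
  two-element set of its endvertices.
\<close>

definition simple_graph :: "'a set \<Rightarrow> 'a set set \<Rightarrow> bool" where
  "simple_graph V E \<longleftrightarrow> finite V \<and> (\<forall>e\<in>E. e \<subseteq> V \<and> card e = 2)"

definition degree :: "'a set set \<Rightarrow> 'a \<Rightarrow> nat" where
  "degree E v = card {e \<in> E. v \<in> e}"

definition regular :: "nat \<Rightarrow> 'a set \<Rightarrow> 'a set set \<Rightarrow> bool" where
  "regular r V E \<longleftrightarrow> (\<forall>v\<in>V. degree E v = r)"

fun path_edges :: "'a list \<Rightarrow> 'a set set" where
  "path_edges (x # y # xs) = insert {x, y} (path_edges (y # xs))"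
| "path_edges _ = {}"

text \<open>A path with vertex sequence \<open>p\<close> has \<open>length p - 1\<close> edges.\<close>

definition is_path :: "'a set \<Rightarrow> 'a set set \<Rightarrow> 'a list \<Rightarrow> bool" where
  "is_path V E p \<longleftrightarrow> p \<noteq> [] \<and> distinct p \<and> set p \<subseteq> V \<and> path_edges p \<subseteq> E"

text \<open>
  The list \<open>c\<close> enumerates each vertex of the cycle once, so the cycle has \<open>length c\<close>
  edges, one of them joining \<open>last c\<close> to \<open>hd c\<close>.
\<close>

definition cycle_edges :: "'a list \<Rightarrow> 'a set set" where
  "cycle_edges c = insert {last c, hd c} (path_edges c)"

definition is_cycle :: "'a set \<Rightarrow> 'a set set \<Rightarrow> 'a list \<Rightarrow> bool" where
  "is_cycle V E c \<longleftrightarrow> 3 \<le> length c \<and> distinct c \<and> set c \<subseteq> V \<and> cycle_edges c \<subseteq> E"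

text \<open>
  A component is represented by its vertex set \<open>C\<close>; as a graph it is the subgraph
  with edge set \<open>induced_edges E C\<close>.
\<close>

definition components :: "'a set \<Rightarrow> 'a set set \<Rightarrow> 'a set set" where
  "components V E = {{w. \<exists>p. is_path V E p \<and> hd p = v \<and> last p = w} |v. v \<in> V}"

definition induced_edges :: "'a set set \<Rightarrow> 'a set \<Rightarrow> 'a set set" where
  "induced_edges E C = {e \<in> E. e \<subseteq> C}"

definition cyclic_edge_cut :: "'a set \<Rightarrow> 'a set set \<Rightarrow> 'a set set \<Rightarrow> bool" where
  "cyclic_edge_cut V E F \<longleftrightarrow> F \<subseteq> E \<and>
     (\<exists>C \<in> components V (E - F). \<exists>D \<in> components V (E - F). C \<noteq> D \<and>
        (\<exists>c. is_cycle C (induced_edges (E - F) C) c) \<and>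
        (\<exists>d. is_cycle D (induced_edges (E - F) D) d))"

definition odd_cyclic_edge_cut :: "'a set \<Rightarrow> 'a set set \<Rightarrow> 'a set set \<Rightarrow> bool" where
  "odd_cyclic_edge_cut V E F \<longleftrightarrow> cyclic_edge_cut V E F \<and>
     (\<exists>C \<in> components V (E - F).
        \<exists>c. is_cycle C (induced_edges (E - F) C) c \<and> odd (length c))"

text \<open>The infimum of the empty set in \<^typ>\<open>enat\<close> is \<open>\<infinity>\<close>.\<close>

definition lambda_oc :: "'a set \<Rightarrow> 'a set set \<Rightarrow> enat" where
  "lambda_oc V E = (INF F \<in> {F. odd_cyclic_edge_cut V E F}. enat (card F))"

text \<open>Edges in different components have distance \<open>\<infinity>\<close>.\<close>

definition edge_dist :: "'a set \<Rightarrow> 'a set set \<Rightarrow> 'a set \<Rightarrow> 'a set \<Rightarrow> enat" where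
  "edge_dist V E e f =
     (INF p \<in> {p. is_path V E p \<and> hd p \<in> e \<and> last p \<in> f}. enat (length p - 1))"

definition matching :: "'a set set \<Rightarrow> 'a set set \<Rightarrow> bool" where
  "matching E M \<longleftrightarrow> M \<subseteq> E \<and> pairwise disjnt M"

definition distance_matching :: "nat \<Rightarrow> 'a set \<Rightarrow> 'a set set \<Rightarrow> 'a set set \<Rightarrow> bool" where
  "distance_matching d V E M \<longleftrightarrow>
     matching E M \<and> (\<forall>e\<in>M. \<forall>f\<in>M. e \<noteq> f \<longrightarrow> enat d \<le> edge_dist V E e f)"

definition perfect_matching :: "'a set \<Rightarrow> 'a set set \<Rightarrow> 'a set set \<Rightarrow> bool" where
  "perfect_matching V E M \<longleftrightarrow> matching E M \<and> \<Union>M = V"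

definition extends_to_perfect_matching :: "'a set \<Rightarrow> 'a set set \<Rightarrow> 'a set set \<Rightarrow> bool" where
  "extends_to_perfect_matching V E M \<longleftrightarrow> (\<exists>M'. perfect_matching V E M' \<and> M \<subseteq> M')"

text \<open>
  An ear is represented by its edge set \<open>A\<close>, which is nonempty and hence determines the
  ear as a subgraph. The vertices in \<open>butlast (tl p)\<close> are the internal vertices of \<open>p\<close>.
\<close>

definition is_ear :: "'a set \<Rightarrow> 'a set set \<Rightarrow> 'a set \<Rightarrow> 'a set set \<Rightarrow> bool" where
  "is_ear V E U A \<longleftrightarrow>
     (\<exists>p. is_path V E p \<and> 2 \<le> length p \<and> hd p \<in> U \<and> last p \<in> U \<and>
          set (butlast (tl p)) \<inter> U = {} \<and> A = path_edges p) \<or>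
     (\<exists>c. is_cycle V E c \<and> card (set c \<inter> U) = 1 \<and> A = cycle_edges c)"

definition is_odd_ear :: "'a set \<Rightarrow> 'a set set \<Rightarrow> 'a set \<Rightarrow> 'a set set \<Rightarrow> bool" where
  "is_odd_ear V E U A \<longleftrightarrow> is_ear V E U A \<and> odd (card A)"

end

theory Submission
  imports Defs
begin

text \<open>
  Let \<open>U\<close> be the set of vertices covered by \<open>M\<close>. If \<open>M\<close> does not extend, Tutte's theorem
  gives \<open>S \<subseteq> V - U\<close> such that \<open>V - U - S\<close> has at least \<open>card S + 2\<close> odd parts. A non-bipartite
  part \<open>C\<close> would send at least \<open>(2 m - 1) (r - 1)\<close> edges to \<open>U \<union> S\<close>, because \<open>V - C\<close> contains a
  cycle: otherwise, \<open>M\<close> being a distance 3 matching, each vertex outside \<open>U\<close> would have at most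
  one neighbour in \<open>U\<close>, and the other parts together with \<open>S\<close> would span too many edges for a
  forest. As every odd part sends at least \<open>r\<close> edges to \<open>U \<union> S\<close>, this exceeds the
  \<open>r card S + 2 m (r - 1)\<close> edges that can leave \<open>U \<union> S\<close>. So all parts are bipartite. Let \<open>W\<close> be
  the union of the larger colour classes. It is independent and misses \<open>U\<close>, so every odd ear has
  an edge inside \<open>V - W\<close>; but by regularity \<open>V - W\<close> spans at most \<open>m r - r\<close> edges.
\<close>

section \<open>Hall's theorem\<close>

lemma hall:
  fixes N :: "'b \<Rightarrow> 'a set"
  assumes "finite I" and "\<And>i. i \<in> I \<Longrightarrow> finite (N i)"
    and "\<And>J. J \<subseteq> I \<Longrightarrow> card J \<le> card (\<Union>(N ` J))"
  shows "\<exists>f. inj_on f I \<and> (\<forall>i\<in>I. f i \<in> N i)"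
  using assms
proof (induction "card I" arbitrary: I N rule: less_induct)
  case less
  note fin = \<open>finite I\<close> and finN = less.prems(2) and hall = less.prems(3)
  show ?case
  proof (cases "I = {}")
    case True
    then show ?thesis by simp
  next
    case False
    show ?thesis
    proof (cases "\<exists>J. J \<subset> I \<and> J \<noteq> {} \<and> card (\<Union>(N ` J)) \<le> card J")
      case True
      then obtain J where J: "J \<subset> I" "J \<noteq> {}" "card (\<Union>(N ` J)) \<le> card J" by blast
      let ?A = "\<Union>(N ` J)"
      have finJ: "finite J" using J fin finite_subset by blast
      have finA: "finite ?A" using finJ finN J by blast
      have "\<exists>f. inj_on f J \<and> (\<forall>i\<in>J. f i \<in> N i)"
        using J fin by (intro less.hyps finJ finN hall) (auto intro: psubset_card_mono)
      then obtain f where f: "inj_on f J" "\<forall>i\<in>J. f i \<in> N i" by blast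
      have "\<exists>g. inj_on g (I - J) \<and> (\<forall>i\<in>I - J. g i \<in> N i - ?A)"
      proof (rule less.hyps)
        show "card (I - J) < card I" using J fin by (intro psubset_card_mono) auto
        show "finite (I - J)" using fin by simp
        show "finite (N i - ?A)" if "i \<in> I - J" for i using finN that by simp
        fix K assume K: "K \<subseteq> I - J"
        then have finK: "finite K" using fin finite_subset by blast
        have "card J + card K = card (J \<union> K)"
          using K finJ finK by (intro card_Un_disjoint[symmetric]) auto
        also have "\<dots> \<le> card (\<Union>(N ` (J \<union> K)))" using J K by (intro hall) auto
        also have "\<Union>(N ` (J \<union> K)) = ?A \<union> (\<Union>i\<in>K. N i - ?A)" by auto
        also have "card \<dots> \<le> card ?A + card (\<Union>i\<in>K. N i - ?A)" by (rule card_Un_le)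
        finally show "card K \<le> card (\<Union>i\<in>K. N i - ?A)" using J by linarith
      qed
      then obtain g where g: "inj_on g (I - J)" "\<forall>i\<in>I - J. g i \<in> N i - ?A" by blast
      let ?h = "\<lambda>i. if i \<in> J then f i else g i"
      have "inj_on ?h I"
      proof (rule inj_onI)
        fix i j assume ij: "i \<in> I" "j \<in> I" "?h i = ?h j"
        show "i = j"
        proof (cases "i \<in> J \<longleftrightarrow> j \<in> J")
          case True
          then show ?thesis using ij f g by (auto split: if_splits dest: inj_onD)
        next
          case False
          then show ?thesis using ij f g by (auto split: if_splits) (metis DiffI DiffE UN_I)+
        qed
      qed
      then show ?thesis using f g J by (intro exI[of _ ?h]) auto
    next
      case strict: False
      obtain i where i: "i \<in> I" using False by blast
      have "card {i} \<le> card (\<Union>(N ` {i}))" using i by (intro hall) auto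
      then obtain x where x: "x \<in> N i" by fastforce
      have "\<exists>f. inj_on f (I - {i}) \<and> (\<forall>j\<in>I - {i}. f j \<in> N j - {x})"
      proof (rule less.hyps)
        show "card (I - {i}) < card I" using i fin by (meson card_Diff1_less)
        show "finite (I - {i})" using fin by simp
        show "finite (N j - {x})" if "j \<in> I - {i}" for j using finN that by simp
        fix K assume K: "K \<subseteq> I - {i}"
        show "card K \<le> card (\<Union>j\<in>K. N j - {x})"
        proof (cases "K = {}")
          case False
          have "K \<subset> I" using K i by blast
          then have "card K < card (\<Union>(N ` K))" using strict False by (meson not_less)
          moreover have "(\<Union>j\<in>K. N j - {x}) = \<Union>(N ` K) - {x}" by auto
          moreover have "finite (\<Union>(N ` K))" using K fin finN finite_subset by blast
          ultimately show ?thesis by (auto simp: card_Diff_singleton_if)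
        qed simp
      qed
      then obtain f where f: "inj_on f (I - {i})" "\<forall>j\<in>I - {i}. f j \<in> N j - {x}" by blast
      have "inj_on (f(i := x)) I"
        using f by (auto simp: inj_on_def)
      then show ?thesis using f x i by (intro exI[of _ "f(i := x)"]) auto
    qed
  qed
qed

section \<open>Tutte's theorem\<close>

definition separated :: "'a set \<Rightarrow> 'a set set \<Rightarrow> 'a set \<Rightarrow> 'a set \<Rightarrow> bool" where
  "separated X E S P \<longleftrightarrow> P \<subseteq> X - S \<and> (\<forall>x\<in>P. \<forall>y\<in>X - S - P. {x, y} \<notin> E)"

text \<open>
  Unions of components of \<open>X - S\<close> are used in place of components, so that connectedness
  plays no role.
\<close>

definition odd_parts :: "'a set \<Rightarrow> 'a set set \<Rightarrow> 'a set \<Rightarrow> 'a set set \<Rightarrow> bool" where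
  "odd_parts X E S \<P> \<longleftrightarrow>
     S \<subseteq> X \<and> pairwise disjnt \<P> \<and> (\<forall>P\<in>\<P>. separated X E S P \<and> odd (card P))"

lemma separated_rest:
  assumes "\<forall>P\<in>\<P>. separated X E S P"
  shows "separated X E S (X - S - \<Union>\<P>)"
  unfolding separated_def
proof (intro conjI ballI)
  fix x y assume x: "x \<in> X - S - \<Union>\<P>" and "y \<in> X - S - (X - S - \<Union>\<P>)"
  then obtain P where P: "P \<in> \<P>" "y \<in> P" by blast
  then have "{y, x} \<notin> E" using assms x by (auto simp: separated_def)
  then show "{x, y} \<notin> E" by (simp add: insert_commute)
qed auto

lemma odd_parts_finite:
  assumes "finite X" and "odd_parts X E S \<P>"
  shows "finite \<P>" and "P \<in> \<P> \<Longrightarrow> finite P" and "finite S"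
proof -
  have "\<P> \<subseteq> Pow X" using assms(2) by (auto simp: odd_parts_def separated_def)
  then show "finite \<P>" "P \<in> \<P> \<Longrightarrow> finite P" "finite S"
    using assms by (auto intro: finite_subset simp: odd_parts_def)
qed

lemma even_sum_odd:
  fixes f :: "'b \<Rightarrow> nat"
  assumes "finite A" and "\<forall>a\<in>A. odd (f a)"
  shows "even (sum f A) \<longleftrightarrow> even (card A)"
  using assms by (induction A rule: finite_induct) auto

lemma odd_parts_parity:
  assumes "finite X" and "odd_parts X E S \<P>"
  shows "even (card X) \<longleftrightarrow> even (card S + card \<P> + card (X - S - \<Union>\<P>))"
proof -
  let ?R = "X - S - \<Union>\<P>"
  note fin = odd_parts_finite[OF assms]
  have sub: "\<Union>\<P> \<subseteq> X - S" "S \<subseteq> X"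
    using assms(2) by (auto simp: odd_parts_def separated_def)
  then have "X = S \<union> (\<Union>\<P> \<union> ?R)" by blast
  moreover have "card (S \<union> (\<Union>\<P> \<union> ?R)) = card S + card (\<Union>\<P> \<union> ?R)"
    using sub assms(1) fin by (intro card_Un_disjoint) auto
  moreover have "card (\<Union>\<P> \<union> ?R) = card (\<Union>\<P>) + card ?R"
    using sub assms(1) fin by (intro card_Un_disjoint) auto
  moreover have "card (\<Union>\<P>) = sum card \<P>"
    using assms(2) fin by (intro card_Union_disjoint) (auto simp: odd_parts_def)
  moreover have "even (sum card \<P>) \<longleftrightarrow> even (card \<P>)"
    using assms(2) fin by (intro even_sum_odd) (auto simp: odd_parts_def)
  ultimately show ?thesis by (metis even_add)
qed

lemma odd_parts_insert_rest:
  assumes "finite X" and "odd_parts X E S \<P>" and "odd (card (X - S - \<Union>\<P>))"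
  shows "odd_parts X E S (insert (X - S - \<Union>\<P>) \<P>)"
    and "card (insert (X - S - \<Union>\<P>) \<P>) = card \<P> + 1"
proof -
  let ?R = "X - S - \<Union>\<P>"
  have "separated X E S ?R"
    using assms(2) by (intro separated_rest) (auto simp: odd_parts_def)
  then show "odd_parts X E S (insert ?R \<P>)"
    using assms(2,3) by (auto simp: odd_parts_def pairwise_insert disjnt_def)
  have "?R \<noteq> {}" using assms(3) by (metis card.empty even_zero)
  then have "?R \<notin> \<P>" by blast
  then show "card (insert ?R \<P>) = card \<P> + 1"
    using odd_parts_finite[OF assms(1,2)] by simp
qed

lemma odd_parts_even_improve:
  assumes "finite X" and "even (card X)" and "odd_parts X E S \<P>" and "card S < card \<P>"
  obtains \<Q> where "odd_parts X E S \<Q>" and "card S + 2 \<le> card \<Q>"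
proof (cases "card S + 2 \<le> card \<P>")
  case True
  then show ?thesis using assms(3) that by blast
next
  case False
  then have k: "card \<P> = card S + 1" using assms(4) by simp
  then have "odd (card (X - S - \<Union>\<P>))"
    using odd_parts_parity[OF assms(1,3)] assms(2) by simp
  then show ?thesis using odd_parts_insert_rest[OF assms(1,3)] k that by simp
qed

text \<open>
  West's argument: take \<open>S\<close> maximal with \<open>card \<P> = card S\<close>. Maximality makes \<open>\<P>\<close> cover
  \<open>X - S\<close> and makes every \<open>P - {v}\<close> satisfy the condition again, while Hall's theorem
  matches \<open>S\<close> to the members of \<open>\<P>\<close>.
\<close>

theorem tutte:
  assumes "finite X"
    and "\<And>S \<P>. odd_parts X E S \<P> \<Longrightarrow> card \<P> \<le> card S"
  shows "\<exists>M. perfect_matching X E M"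
  using assms
proof (induction "card X" arbitrary: X rule: less_induct)
  case less
  note finX = \<open>finite X\<close> and bound = less.prems(2)
  have evX: "even (card X)"
  proof (rule ccontr)
    assume "odd (card X)"
    then have "odd_parts X E {} {X}" by (auto simp: odd_parts_def separated_def)
    from bound[OF this] show False by simp
  qed
  let ?T = "\<lambda>S. \<exists>\<P>. odd_parts X E S \<P> \<and> card \<P> = card S"
  have "?T {}" by (intro exI[of _ "{}"]) (auto simp: odd_parts_def)
  moreover have "\<forall>S. ?T S \<longrightarrow> card S < Suc (card X)"
    using finX by (auto simp: odd_parts_def less_Suc_eq_le intro: card_mono)
  ultimately have "\<exists>S. ?T S \<and> (\<forall>S'. ?T S' \<longrightarrow> card S' \<le> card S)"
    by (rule Lattices_Big.ex_has_greatest_nat)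
  then obtain S where S: "?T S" and maxS: "\<And>S'. ?T S' \<Longrightarrow> card S' \<le> card S" by blast
  then obtain \<P> where \<P>: "odd_parts X E S \<P>" and k: "card \<P> = card S" by blast
  note fin = odd_parts_finite[OF finX \<P>]
  have SX: "S \<subseteq> X" and disj: "pairwise disjnt \<P>"
    and part: "\<And>P. P \<in> \<P> \<Longrightarrow> separated X E S P" "\<And>P. P \<in> \<P> \<Longrightarrow> odd (card P)"
    using \<P> by (auto simp: odd_parts_def)
  have no_larger: False if "odd_parts X E S' \<Q>" "card S < card S'" "card S' \<le> card \<Q>" for S' \<Q>
    using maxS[of S'] bound[OF that(1)] that by (metis le_antisym not_le)
  define R where "R = X - S - \<Union>\<P>"
  have sepR: "separated X E S R"
    unfolding R_def using part by (intro separated_rest) auto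
  have evR: "even (card R)"
    using odd_parts_parity[OF finX \<P>] evX k by (simp add: R_def)
  have "R = {}"
  proof (rule ccontr)
    assume "R \<noteq> {}"
    then obtain v where v: "v \<in> R" by blast
    have finR: "finite R" using finX by (simp add: R_def)
    have "odd (card (R - {v}))"
      using v evR finR by (metis card_Suc_Diff1 even_Suc)
    moreover have "separated X E (insert v S) P" if "P \<in> \<P>" for P
      using part(1)[OF that] v that by (auto simp: separated_def R_def)
    moreover have "separated X E (insert v S) (R - {v})"
      using sepR by (auto simp: separated_def)
    moreover have "disjnt (R - {v}) P" "disjnt P (R - {v})" if "P \<in> \<P>" for P
      using that by (auto simp: R_def disjnt_def)
    ultimately have "odd_parts X E (insert v S) (insert (R - {v}) \<P>)"
      using disj SX part v by (auto simp: odd_parts_def pairwise_insert R_def)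
    moreover have "R - {v} \<notin> \<P>"
    proof
      assume *: "R - {v} \<in> \<P>"
      then have "R - {v} = {}" by (auto simp: R_def)
      then show False using part(2)[OF *] by (metis card.empty even_zero)
    qed
    ultimately show False
      using no_larger[of "insert v S" "insert (R - {v}) \<P>"] v fin k by (simp add: R_def)
  qed
  then have cover: "X = S \<union> \<Union>\<P>"
    using SX part by (auto simp: R_def separated_def)
  define N where "N = (\<lambda>P. {s \<in> S. \<exists>x\<in>P. {x, s} \<in> E})"
  have "\<exists>f. inj_on f \<P> \<and> (\<forall>P\<in>\<P>. f P \<in> N P)"
  proof (rule hall)
    show "finite \<P>" by (rule fin)
    show "finite (N P)" for P using fin by (simp add: N_def)
    fix \<J> assume \<J>: "\<J> \<subseteq> \<P>"
    have "separated X E (\<Union>(N ` \<J>)) P" if "P \<in> \<J>" for P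
      using part(1)[OF subsetD[OF \<J> that]] that by (auto simp: separated_def N_def)
    then have "odd_parts X E (\<Union>(N ` \<J>)) \<J>"
      unfolding odd_parts_def
    proof (intro conjI ballI)
      show "\<Union>(N ` \<J>) \<subseteq> X" using SX by (auto simp: N_def)
      show "pairwise disjnt \<J>" using disj \<J> by (rule pairwise_subset)
      show "odd (card P)" if "P \<in> \<J>" for P using part(2) \<J> that by blast
    qed
    then show "card \<J> \<le> card (\<Union>(N ` \<J>))" by (rule bound)
  qed
  then obtain f where f: "inj_on f \<P>" "\<And>P. P \<in> \<P> \<Longrightarrow> f P \<in> N P" by blast
  have fS: "f ` \<P> = S"
  proof (rule card_subset_eq)
    show "finite S" by (rule fin)
    show "f ` \<P> \<subseteq> S" using f by (auto simp: N_def)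
    show "card (f ` \<P>) = card S" using f k by (simp add: card_image)
  qed
  have "\<forall>P\<in>\<P>. \<exists>x\<in>P. {x, f P} \<in> E" using f by (auto simp: N_def)
  then obtain x where x: "\<And>P. P \<in> \<P> \<Longrightarrow> x P \<in> P" "\<And>P. P \<in> \<P> \<Longrightarrow> {x P, f P} \<in> E"
    by metis
  have "\<exists>M. perfect_matching (P - {x P}) E M" if P: "P \<in> \<P>" for P
  proof (rule less.hyps)
    let ?v = "x P" let ?Y = "P - {x P}"
    have PX: "P \<subseteq> X - S" using part P by (auto simp: separated_def)
    have finP: "finite P" using fin P by blast
    show "card ?Y < card X"
      using x P PX finX by (intro psubset_card_mono) auto
    show finY: "finite ?Y" using finP by simp
    have evY: "even (card ?Y)"
      using part(2)[OF P] x[OF P] finP by (metis card_Suc_Diff1 even_Suc)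
    fix S' \<Q>' assume "odd_parts ?Y E S' \<Q>'"
    show "card \<Q>' \<le> card S'"
    proof (rule ccontr)
      assume "\<not> card \<Q>' \<le> card S'"
      then obtain \<Q> where \<Q>: "odd_parts ?Y E S' \<Q>" and k': "card S' + 2 \<le> card \<Q>"
        using odd_parts_even_improve[OF finY evY \<open>odd_parts ?Y E S' \<Q>'\<close>] by force
      let ?S = "S \<union> insert ?v S'" let ?Q = "(\<P> - {P}) \<union> \<Q>"
      note fin' = odd_parts_finite[OF finY \<Q>]
      have S': "S' \<subseteq> ?Y" using \<Q> by (auto simp: odd_parts_def)
      have sub: "Q \<subseteq> ?Y - S'" if "Q \<in> \<Q>" for Q
        using \<Q> that by (auto simp: odd_parts_def separated_def)
      have dP: "P' \<inter> P = {}" if "P' \<in> \<P> - {P}" for P'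
        using disj that P by (auto simp: pairwise_def disjnt_def)
      have 1: "separated X E ?S P'" if "P' \<in> \<P> - {P}" for P'
        using part(1)[of P'] that dP[OF that] S' x[OF P] by (auto simp: separated_def)
      have 2: "separated X E ?S Q" if "Q \<in> \<Q>" for Q
        unfolding separated_def
      proof (intro conjI ballI)
        show "Q \<subseteq> X - ?S" using sub[OF that] PX by auto
        fix a b assume a: "a \<in> Q" and b: "b \<in> X - ?S - Q"
        have aP: "a \<in> P" using sub[OF that] a by auto
        show "{a, b} \<notin> E"
        proof (cases "b \<in> P")
          case True
          then show ?thesis using \<Q> that a b by (auto simp: odd_parts_def separated_def)
        next
          case False
          then show ?thesis using part(1)[OF P] aP b by (auto simp: separated_def)
        qed
      qed
      have 3: "disjnt P' Q" "disjnt Q P'" if "P' \<in> \<P> - {P}" "Q \<in> \<Q>" for P' Q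
        using dP[OF that(1)] sub[OF that(2)] by (auto simp: disjnt_def)
      have "pairwise disjnt ?Q"
      proof (rule pairwiseI)
        fix A B assume "A \<in> ?Q" "B \<in> ?Q" "A \<noteq> B"
        moreover have "pairwise disjnt \<Q>" using \<Q> by (simp add: odd_parts_def)
        ultimately show "disjnt A B" using 3 disj by (elim UnE) (auto dest: pairwiseD)
      qed
      then have "odd_parts X E ?S ?Q"
        unfolding odd_parts_def
      proof (intro conjI ballI)
        show "?S \<subseteq> X" using SX S' PX x(1)[OF P] by auto
        fix A assume A: "A \<in> ?Q"
        show "separated X E ?S A" using A 1 2 by (elim UnE)
        show "odd (card A)" using A part(2) \<Q> by (auto simp: odd_parts_def)
      qed
      moreover have "card ?S = card S + (1 + card S')"
      proof -
        have "card ?S = card S + card (insert ?v S')"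
          using S' PX x[OF P] fin fin' by (intro card_Un_disjoint) auto
        moreover have "?v \<notin> S'" using S' by blast
        ultimately show ?thesis using fin'(3) by simp
      qed
      moreover have "card ?Q = card (\<P> - {P}) + card \<Q>"
      proof (rule card_Un_disjoint)
        show "(\<P> - {P}) \<inter> \<Q> = {}"
        proof (rule ccontr)
          assume "(\<P> - {P}) \<inter> \<Q> \<noteq> {}"
          then obtain Q where Q: "Q \<in> \<P> - {P}" "Q \<in> \<Q>" by blast
          then have "Q = {}" using 3 by (auto simp: disjnt_def)
          moreover have "odd (card Q)" using part(2) Q by blast
          ultimately show False by simp
        qed
      qed (use fin fin' in auto)
      moreover have "card \<P> = Suc (card (\<P> - {P}))"
        using P fin by (metis card_Suc_Diff1)
      ultimately show False using no_larger[of ?S ?Q] k k' by linarith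
    qed
  qed
  then obtain M where M: "\<And>P. P \<in> \<P> \<Longrightarrow> perfect_matching (P - {x P}) E (M P)"
    by metis
  define L where "L = (\<lambda>P. insert {x P, f P} (M P))"
  have L: "\<Union>(L P) = insert (f P) P" if "P \<in> \<P>" for P
    using M[OF that] x(1)[OF that] by (auto simp: L_def perfect_matching_def)
  have dL: "disjnt (insert (f P) P) (insert (f Q) Q)" if "P \<in> \<P>" "Q \<in> \<P>" "P \<noteq> Q" for P Q
  proof -
    have "f P \<noteq> f Q" using f that by (meson inj_onD)
    moreover have "f P \<in> S" "f Q \<in> S" using fS that by auto
    moreover have "P \<inter> S = {}" "Q \<inter> S = {}" using part that by (auto simp: separated_def)
    moreover have "P \<inter> Q = {}" using disj that by (auto simp: pairwise_def disjnt_def)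
    ultimately show ?thesis by (auto simp: disjnt_def)
  qed
  have inL: "disjnt a b" if P: "P \<in> \<P>" and ab: "a \<in> L P" "b \<in> L P" "a \<noteq> b" for P a b
  proof -
    have fP: "f P \<notin> P" using fS part(1)[OF P] P by (auto simp: separated_def)
    have MP: "pairwise disjnt (M P)" "\<Union>(M P) = P - {x P}"
      using M[OF P] by (auto simp: perfect_matching_def matching_def)
    have new: "disjnt {x P, f P} c" "disjnt c {x P, f P}" if "c \<in> M P" for c
    proof -
      have "c \<subseteq> P - {x P}" using MP(2) that by blast
      then show "disjnt {x P, f P} c" "disjnt c {x P, f P}" using fP by (auto simp: disjnt_def)
    qed
    consider "a \<in> M P" "b \<in> M P" | "a = {x P, f P}" "b \<in> M P" | "a \<in> M P" "b = {x P, f P}"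
      using ab unfolding L_def by blast
    then show ?thesis
      using new pairwiseD[OF MP(1) _ _ ab(3)] by cases simp_all
  qed
  have "pairwise disjnt (\<Union>(L ` \<P>))"
  proof (rule pairwiseI)
    fix a b assume "a \<in> \<Union>(L ` \<P>)" "b \<in> \<Union>(L ` \<P>)" and ab: "a \<noteq> b"
    then obtain P Q where PQ: "P \<in> \<P>" "Q \<in> \<P>" "a \<in> L P" "b \<in> L Q" by blast
    show "disjnt a b"
    proof (cases "P = Q")
      case True
      then show ?thesis using inL PQ ab by blast
    next
      case False
      have "a \<subseteq> insert (f P) P" "b \<subseteq> insert (f Q) Q" using L PQ by blast+
      then show ?thesis using dL[OF PQ(1,2) False] unfolding disjnt_def by blast
    qed
  qed
  moreover have "\<Union>(\<Union>(L ` \<P>)) = X"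
  proof -
    have "\<Union>(\<Union>(L ` \<P>)) = (\<Union>P\<in>\<P>. \<Union>(L P))" by blast
    also have "\<dots> = (\<Union>P\<in>\<P>. insert (f P) P)" using L by simp
    also have "\<dots> = X" using fS cover by auto
    finally show ?thesis .
  qed
  moreover have "\<Union>(L ` \<P>) \<subseteq> E"
    using M x by (auto simp: L_def perfect_matching_def matching_def)
  ultimately show ?case unfolding perfect_matching_def matching_def by blast
qed

section \<open>Paths and cycles\<close>

lemma path_edges_append:
  "path_edges (xs @ ys) = path_edges xs \<union> path_edges ys \<union>
     (if xs \<noteq> [] \<and> ys \<noteq> [] then {{last xs, hd ys}} else {})"
proof (induction xs)
  case (Cons x xs)
  then show ?case by (cases xs; cases ys) auto
qed simp

lemma path_edges_subset: "e \<in> path_edges p \<Longrightarrow> e \<subseteq> set p"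
  by (induction p rule: path_edges.induct) auto

lemma finite_path_edges: "finite (path_edges p)"
  by (induction p rule: path_edges.induct) auto

lemma card_path_edges: "distinct p \<Longrightarrow> card (path_edges p) = length p - 1"
proof (induction p rule: path_edges.induct)
  case (1 x y xs)
  then have "{x, y} \<notin> path_edges (y # xs)" using path_edges_subset by fastforce
  then show ?case using 1 by (simp add: finite_path_edges)
qed auto

lemma card_cycle_edges:
  assumes "distinct c" and "3 \<le> length c"
  shows "card (cycle_edges c) = length c"
proof -
  obtain x c' where x: "c = x # c'" using assms(2) by (cases c) auto
  obtain y xs where y: "c' = y # xs" using assms(2) x by (cases c') auto
  have c: "c = x # y # xs" and xs: "xs \<noteq> []" using assms(2) x y by auto
  have "last c \<in> set xs" using c xs by simp
  then have "last c \<noteq> y" "last c \<noteq> x" using assms(1) c by auto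
  moreover have "x \<notin> e" if "e \<in> path_edges (y # xs)" for e
    using path_edges_subset[OF that] assms(1) c by auto
  ultimately have "{last c, hd c} \<notin> path_edges c"
    using c by (auto simp: doubleton_eq_iff)
  then show ?thesis
    using card_path_edges[OF assms(1)] assms(2) by (simp add: cycle_edges_def finite_path_edges)
qed

lemma path_alternates:
  assumes "p \<noteq> []" and "\<And>x y. {x, y} \<in> path_edges p \<Longrightarrow> f x \<noteq> (f y :: bool)"
  shows "f (hd p) = f (last p) \<longleftrightarrow> odd (length p)"
  using assms
proof (induction p rule: path_edges.induct)
  case (1 x y xs)
  have "f x \<noteq> f y" using "1.prems"(2) by simp
  moreover have "f (hd (y # xs)) = f (last (y # xs)) \<longleftrightarrow> odd (length (y # xs))"
    using 1 by simp
  ultimately show ?case by auto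
qed auto

lemma path_prefix:
  assumes "is_path V E p" and "w \<in> set p"
  obtains q where "is_path V E q" and "hd q = hd p" and "last q = w" and "set q \<subseteq> set p"
    and "path_edges q \<subseteq> path_edges p"
proof -
  obtain a b where p: "p = a @ w # b" using split_list[OF assms(2)] by blast
  have "p = (a @ [w]) @ b" using p by simp
  then have "path_edges (a @ [w]) \<subseteq> path_edges p" by (metis path_edges_append Un_upper1 Un_assoc)
  then show thesis using assms(1) p
    by (intro that[of "a @ [w]"]) (auto simp: is_path_def hd_append)
qed

lemma path_extend:
  assumes "is_path V E p" and "{last p, w} \<in> E" and "w \<in> V"
  obtains q where "is_path V E q" and "hd q = hd p" and "last q = w"
proof (cases "w \<in> set p")
  case True
  then show ?thesis using path_prefix[OF assms(1) True] that by blast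
next
  case False
  then show ?thesis using assms
    by (intro that[of "p @ [w]"]) (auto simp: is_path_def path_edges_append)
qed

lemma path_stays:
  assumes "path_edges p \<subseteq> E" and "p \<noteq> []" and "hd p \<in> C"
    and "\<And>e. e \<in> E \<Longrightarrow> e \<subseteq> C \<or> e \<inter> C = {}"
  shows "set p \<subseteq> C"
  using assms
proof (induction p rule: path_edges.induct)
  case (1 x y xs)
  have "{x, y} \<subseteq> C \<or> {x, y} \<inter> C = {}" using 1 by (intro "1.prems"(4)) simp
  then show ?case using 1 by auto
qed auto

section \<open>Counting arcs\<close>

definition arcs :: "'a set set \<Rightarrow> 'a set \<Rightarrow> 'a set \<Rightarrow> nat" where
  "arcs E X Y = (\<Sum>x\<in>X. \<Sum>y\<in>Y. of_bool ({x, y} \<in> E))"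

lemma arcs_commute: "arcs E X Y = arcs E Y X"
  unfolding arcs_def by (subst sum.swap) (simp add: insert_commute)

lemma arcs_Un_left:
  "finite X \<Longrightarrow> finite X' \<Longrightarrow> X \<inter> X' = {} \<Longrightarrow> arcs E (X \<union> X') Y = arcs E X Y + arcs E X' Y"
  by (simp add: arcs_def sum.union_disjoint)

lemma arcs_Un_right:
  "finite Y \<Longrightarrow> finite Y' \<Longrightarrow> Y \<inter> Y' = {} \<Longrightarrow> arcs E X (Y \<union> Y') = arcs E X Y + arcs E X Y'"
  by (simp add: arcs_commute[of E X] arcs_Un_left)

lemma arcs_Union_left:
  assumes "\<And>P. P \<in> \<P> \<Longrightarrow> finite P" and "pairwise disjnt \<P>"
  shows "arcs E (\<Union>\<P>) Y = (\<Sum>P\<in>\<P>. arcs E P Y)"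
  unfolding arcs_def using assms
  by (subst sum.Union_disjoint) (auto simp: pairwise_def disjnt_def)

lemma arcs_eq_0: "(\<And>x y. x \<in> X \<Longrightarrow> y \<in> Y \<Longrightarrow> {x, y} \<notin> E) \<Longrightarrow> arcs E X Y = 0"
  by (simp add: arcs_def)

lemma arcs_mono_left: "X \<subseteq> X' \<Longrightarrow> finite X' \<Longrightarrow> arcs E X Y \<le> arcs E X' Y"
  unfolding arcs_def by (rule sum_mono2) auto

lemma arcs_mono_right: "Y \<subseteq> Y' \<Longrightarrow> finite Y' \<Longrightarrow> arcs E X Y \<le> arcs E X Y'"
  by (simp add: arcs_commute[of E X] arcs_mono_left)

lemma arcs_singleton: "finite Y \<Longrightarrow> arcs E {x} Y = card {y \<in> Y. {x, y} \<in> E}"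
  by (simp add: arcs_def sum_of_bool_eq Int_def)

lemma arcs_eq_sum: "arcs E X Y = (\<Sum>x\<in>X. arcs E {x} Y)"
  by (simp add: arcs_def)

lemma card_edges_at:
  assumes "\<forall>e\<in>E. card e = 2" and "finite Y" and "v \<in> Y"
  shows "card {e \<in> E. e \<subseteq> Y \<and> v \<in> e} = arcs E {v} Y"
proof -
  have "bij_betw (\<lambda>y. {v, y}) {y \<in> Y. {v, y} \<in> E} {e \<in> E. e \<subseteq> Y \<and> v \<in> e}"
    unfolding bij_betw_def
  proof (intro conjI equalityI subsetI)
    show "inj_on (\<lambda>y. {v, y}) {y \<in> Y. {v, y} \<in> E}"
      by (auto simp: inj_on_def doubleton_eq_iff)
    fix e assume e: "e \<in> {e \<in> E. e \<subseteq> Y \<and> v \<in> e}"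
    then obtain a b where ab: "e = {a, b}" using assms(1) by (auto simp: card_2_iff)
    then have "e = {v, if v = a then b else a}" using e by auto
    then show "e \<in> (\<lambda>y. {v, y}) ` {y \<in> Y. {v, y} \<in> E}" using e by blast
  qed (use assms(3) in auto)
  then show ?thesis using bij_betw_same_card[symmetric] by (simp add: arcs_singleton[OF assms(2)])
qed

lemma arcs_regular:
  assumes "simple_graph V E" and "regular r V E" and "X \<subseteq> V"
  shows "arcs E X V = r * card X"
proof -
  have "arcs E {v} V = r" if "v \<in> X" for v
  proof -
    have "{e \<in> E. e \<subseteq> V \<and> v \<in> e} = {e \<in> E. v \<in> e}"
      using assms(1) by (auto simp: simple_graph_def)
    moreover have "card {e \<in> E. v \<in> e} = r" "v \<in> V"
      using assms that by (auto simp: regular_def degree_def)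
    ultimately show ?thesis
      using card_edges_at[of E V v] assms(1) by (auto simp: simple_graph_def)
  qed
  then show ?thesis by (simp add: arcs_eq_sum[of E X])
qed

lemma arcs_within:
  assumes "\<forall>e\<in>E. card e = 2" and "finite B"
  shows "arcs E B B = 2 * card {e \<in> E. e \<subseteq> B}"
proof -
  let ?F = "{e \<in> E. e \<subseteq> B}"
  have "finite ?F" using assms(2) by (intro finite_subset[of ?F "Pow B"]) auto
  have "arcs E B B = (\<Sum>v\<in>B. card {e \<in> ?F. v \<in> e})"
    using card_edges_at[OF assms] by (subst arcs_eq_sum) (auto intro!: sum.cong simp: conj_ac)
  also have "\<dots> = 2 * card ?F"
  proof (rule sum_multicount)
    show "\<forall>e\<in>?F. card {v \<in> B. v \<in> e} = 2"
    proof
      fix e assume "e \<in> ?F"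
      moreover from this have "{v \<in> B. v \<in> e} = e" by auto
      ultimately show "card {v \<in> B. v \<in> e} = 2" using assms(1) by simp
    qed
  qed fact+
  finally show ?thesis .
qed

lemma card_cut_le_arcs:
  assumes "\<forall>e\<in>E. card e = 2" and "finite C" and "finite D" and "C \<inter> D = {}"
  shows "card {e \<in> E. e \<inter> C \<noteq> {} \<and> e \<inter> D \<noteq> {}} \<le> arcs E C D"
proof -
  let ?A = "{(x, y) \<in> C \<times> D. {x, y} \<in> E}"
  have "{e \<in> E. e \<inter> C \<noteq> {} \<and> e \<inter> D \<noteq> {}} \<subseteq> (\<lambda>(x, y). {x, y}) ` ?A"
  proof
    fix e assume e: "e \<in> {e \<in> E. e \<inter> C \<noteq> {} \<and> e \<inter> D \<noteq> {}}"
    then obtain x y where xy: "x \<in> e" "x \<in> C" "y \<in> e" "y \<in> D" by blast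
    then have "x \<noteq> y" using assms(4) by blast
    moreover have "card e = 2" using e assms(1) by blast
    then obtain a b where "e = {a, b}" unfolding card_2_iff by blast
    ultimately have "e = {x, y}" using xy(1,3) by auto
    then show "e \<in> (\<lambda>(x, y). {x, y}) ` ?A" using e xy by force
  qed
  moreover have fin: "finite ?A" using assms by (auto intro: finite_subset[of _ "C \<times> D"])
  ultimately have "card {e \<in> E. e \<inter> C \<noteq> {} \<and> e \<inter> D \<noteq> {}} \<le> card ?A"
    by (meson card_image_le card_mono finite_imageI le_trans)
  also have "card ?A = (\<Sum>z\<in>C \<times> D. of_bool ({fst z, snd z} \<in> E))"
    using assms by (auto simp: sum_of_bool_eq intro!: arg_cong[of _ _ card])
  also have "\<dots> = arcs E C D"
    by (simp add: arcs_def sum.cartesian_product case_prod_beta)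
  finally show ?thesis .
qed

section \<open>Acyclic and bipartite graphs\<close>

lemma cycle_exists:
  assumes "finite X" and "X \<noteq> {}" and "\<forall>e\<in>E. card e = 2"
    and deg: "\<And>v. v \<in> X \<Longrightarrow> 2 \<le> arcs E {v} X"
  shows "\<exists>c. is_cycle X E c"
proof -
  obtain v0 where "v0 \<in> X" using assms(2) by blast
  then have "is_path X E [v0]" by (simp add: is_path_def)
  moreover have "\<forall>p. is_path X E p \<longrightarrow> length p < Suc (card X)"
    using assms(1) by (auto simp: is_path_def less_Suc_eq_le) (metis card_mono distinct_card)
  ultimately have "\<exists>p. is_path X E p \<and> (\<forall>q. is_path X E q \<longrightarrow> length q \<le> length p)"
    by (rule Lattices_Big.ex_has_greatest_nat)
  then obtain p where p: "is_path X E p"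
    and longest: "\<And>q. is_path X E q \<Longrightarrow> length q \<le> length p" by blast
  then obtain v q where vq: "p = v # q" by (cases p) (auto simp: is_path_def)
  have vX: "v \<in> X" using p vq by (auto simp: is_path_def)
  have nbr: "y \<in> set q" if "y \<in> X" "{v, y} \<in> E" for y
  proof (rule ccontr)
    assume "y \<notin> set q"
    moreover have "y \<noteq> v" using that assms(3) by fastforce
    ultimately have "is_path X E (y # p)"
      using p vq that by (auto simp: is_path_def insert_commute)
    then show False using longest by fastforce
  qed
  have "\<not> card {y \<in> X. {v, y} \<in> E} \<le> 1"
    using deg[OF vX] assms(1) by (simp add: arcs_singleton)
  then have "\<not> {y \<in> X. {v, y} \<in> E} \<subseteq> {hd q}"
    by (metis card_mono card_1_singleton_iff finite.emptyI finite.insertI One_nat_def)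
  then obtain w where w: "w \<in> X" "{v, w} \<in> E" "w \<noteq> hd q" by blast
  obtain a b where q: "q = a @ w # b" using nbr[OF w(1,2)] split_list by metis
  have a: "a \<noteq> []" using w(3) q by auto
  have "p = (v # a @ [w]) @ b" using vq q by simp
  then have "path_edges (v # a @ [w]) \<subseteq> path_edges p"
    by (metis path_edges_append Un_upper1 Un_assoc)
  then have "is_cycle X E (v # a @ [w])"
    using p vq q a w by (auto simp: is_cycle_def is_path_def cycle_edges_def insert_commute Suc_le_eq)
  then show ?thesis by blast
qed

lemma arcs_acyclic:
  assumes "finite X" and "X \<noteq> {}" and "\<forall>e\<in>E. card e = 2" and "\<nexists>c. is_cycle X E c"
  shows "arcs E X X + 2 \<le> 2 * card X"
  using assms
proof (induction "card X" arbitrary: X rule: less_induct)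
  case less
  note fin = \<open>finite X\<close>
  obtain v where v: "v \<in> X" "arcs E {v} X \<le> 1"
    using cycle_exists[of X E] less.prems by fastforce
  have loop: "arcs E {v} {v} = 0" using less.prems(3) by (intro arcs_eq_0) fastforce
  show ?case
  proof (cases "X = {v}")
    case True
    then show ?thesis using loop by simp
  next
    case False
    let ?Y = "X - {v}"
    have X: "X = {v} \<union> ?Y" using v by blast
    have acyclic: "\<nexists>c. is_cycle ?Y E c" using less.prems(4) by (auto simp: is_cycle_def)
    have "arcs E ?Y ?Y + 2 \<le> 2 * card ?Y"
    proof (rule less.hyps)
      show "card ?Y < card X" using fin v(1) by (rule card_Diff1_less)
      show "?Y \<noteq> {}" using False v(1) by blast
    qed (use less.prems acyclic in auto)
    moreover have "arcs E X X = arcs E {v} X + arcs E ?Y X"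
      using arcs_Un_left[of "{v}" ?Y E X] X fin by simp
    moreover have "arcs E ?Y X = arcs E ?Y {v} + arcs E ?Y ?Y"
      using arcs_Un_right[of "{v}" ?Y E ?Y] X fin by simp
    moreover have "arcs E ?Y {v} \<le> 1"
      using v(2) arcs_mono_right[of ?Y X E "{v}"] fin arcs_commute[of E ?Y "{v}"] by simp
    moreover have "card X = card ?Y + 1"
      using v fin by (metis card_Suc_Diff1 Suc_eq_plus1)
    ultimately show ?thesis using v(2) by linarith
  qed
qed

lemma two_colourable:
  assumes "finite E" and "\<forall>e\<in>E. e \<subseteq> X \<and> card e = 2" and "\<nexists>c. is_cycle X E c \<and> odd (length c)"
  shows "\<exists>f :: 'a \<Rightarrow> bool. \<forall>x y. {x, y} \<in> E \<longrightarrow> f x \<noteq> f y"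
  using assms
proof (induction E rule: finite_induct)
  case (insert e F)
  have "\<nexists>c. is_cycle X F c \<and> odd (length c)"
    using insert.prems(2) by (auto simp: is_cycle_def)
  then obtain f :: "'a \<Rightarrow> bool" where f: "\<And>x y. {x, y} \<in> F \<Longrightarrow> f x \<noteq> f y"
    using insert by auto
  obtain x y where e: "e = {x, y}" "x \<noteq> y" and xy: "x \<in> X" "y \<in> X"
    using insert.prems(1) by (auto simp: card_2_iff)
  show ?case
  proof (cases "f x = f y")
    case False
    then show ?thesis using f e by (intro exI[of _ f]) (auto simp: doubleton_eq_iff)
  next
    case True
    define R where "R = {w. \<exists>p. is_path X F p \<and> hd p = y \<and> last p = w}"
    have "is_path X F [y]" using xy by (simp add: is_path_def)
    then have yR: "y \<in> R" by (force simp: R_def)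
    have xR: "x \<notin> R"
    proof
      assume "x \<in> R"
      then obtain p where p: "is_path X F p" "hd p = y" "last p = x" by (auto simp: R_def)
      have "odd (length p)"
        using path_alternates[of p f] p f True by (auto simp: is_path_def)
      moreover have "length p \<noteq> 1" using p e(2) by (cases p) auto
      ultimately have "3 \<le> length p" by presburger
      then have "is_cycle X (insert e F) p"
        using p e by (auto simp: is_path_def is_cycle_def cycle_edges_def)
      then show False using insert.prems(2) \<open>odd (length p)\<close> by blast
    qed
    have "b \<in> R" if "a \<in> R" and ab: "{a, b} \<in> F" for a b
    proof -
      obtain p where p: "is_path X F p" "hd p = y" "last p = a"
        using \<open>a \<in> R\<close> by (auto simp: R_def)
      have "{last p, b} \<in> F" "b \<in> X" using ab insert.prems(1) p(3) by auto
      with p(1) obtain q where "is_path X F q" "hd q = hd p" "last q = b" by (rule path_extend)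
      then show ?thesis using p(2) by (auto simp: R_def)
    qed
    then have closed: "a \<in> R \<longleftrightarrow> b \<in> R" if "{a, b} \<in> F" for a b
      using that by (metis insert_commute)
    define g where "g = (\<lambda>w. if w \<in> R then \<not> f w else f w)"
    have "g a \<noteq> g b" if "{a, b} \<in> insert e F" for a b
    proof (cases "{a, b} \<in> F")
      case True
      then show ?thesis using closed f by (auto simp: g_def)
    next
      case False
      then have "a = x \<and> b = y \<or> a = y \<and> b = x" using that e by (auto simp: doubleton_eq_iff)
      then show ?thesis using xR yR True by (auto simp: g_def)
    qed
    then show ?thesis by blast
  qed
qed simp

section \<open>Odd-cyclic edge cuts\<close>

lemma cycle_in_component:
  assumes "is_cycle V E c"
  obtains X where "X \<in> components V E" and "is_cycle X (induced_edges E X) c"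
    and "\<And>C. hd c \<in> C \<Longrightarrow> (\<And>e. e \<in> E \<Longrightarrow> e \<subseteq> C \<or> e \<inter> C = {}) \<Longrightarrow> X \<subseteq> C"
proof -
  define X where "X = {w. \<exists>p. is_path V E p \<and> hd p = hd c \<and> last p = w}"
  have c: "is_path V E c" "c \<noteq> []"
    using assms by (auto simp: is_cycle_def is_path_def cycle_edges_def)
  then have "hd c \<in> V" by (auto simp: is_path_def)
  then have "X \<in> components V E" by (auto simp: components_def X_def)
  moreover have sub: "set c \<subseteq> X"
  proof
    fix w assume "w \<in> set c"
    then obtain q where "is_path V E q" "hd q = hd c" "last q = w" by (rule path_prefix[OF c(1)])
    then show "w \<in> X" by (auto simp: X_def)
  qed
  moreover have "e \<subseteq> set c" if "e \<in> cycle_edges c" for e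
    using that c(2) path_edges_subset by (fastforce simp: cycle_edges_def)
  ultimately show thesis
  proof (intro that)
    show "is_cycle X (induced_edges E X) c"
      using assms sub \<open>\<And>e. e \<in> cycle_edges c \<Longrightarrow> e \<subseteq> set c\<close>
      by (fastforce simp: is_cycle_def induced_edges_def)
  next
    fix C assume "hd c \<in> C" and C: "\<And>e. e \<in> E \<Longrightarrow> e \<subseteq> C \<or> e \<inter> C = {}"
    show "X \<subseteq> C"
    proof
      fix w assume "w \<in> X"
      then obtain p where p: "is_path V E p" "hd p = hd c" "last p = w" by (auto simp: X_def)
      then have "set p \<subseteq> C"
        using \<open>hd c \<in> C\<close> C by (intro path_stays[of p E C]) (auto simp: is_path_def)
      then show "w \<in> C" using p by (auto simp: is_path_def)
    qed
  qed
qed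

lemma lambda_oc_le_arcs:
  assumes "simple_graph V E" and "C \<subseteq> V"
    and c: "is_cycle C E c" "odd (length c)" and d: "is_cycle (V - C) E d"
  shows "lambda_oc V E \<le> enat (arcs E C (V - C))"
proof -
  define F where "F = {e \<in> E. e \<inter> C \<noteq> {} \<and> e \<inter> (V - C) \<noteq> {}}"
  have E: "\<forall>e\<in>E. card e = 2" "\<And>e. e \<in> E \<Longrightarrow> e \<subseteq> V" and finV: "finite V"
    using assms(1) by (auto simp: simple_graph_def)
  have cycle: "is_cycle V (E - F) c'" if "is_cycle D E c'" "D = C \<or> D = V - C" for c' D
  proof -
    have "c' \<noteq> []" using that(1) by (auto simp: is_cycle_def)
    then have "e \<subseteq> set c'" if "e \<in> cycle_edges c'" for e
      using that path_edges_subset by (fastforce simp: cycle_edges_def)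
    then have "e \<notin> F" if "e \<in> cycle_edges c'" for e
      using \<open>is_cycle D E c'\<close> \<open>D = C \<or> D = V - C\<close> that by (fastforce simp: is_cycle_def F_def)
    then show ?thesis using that assms(2) by (auto simp: is_cycle_def)
  qed
  obtain X where X: "X \<in> components V (E - F)" "is_cycle X (induced_edges (E - F) X) c"
    and XC: "\<And>D. hd c \<in> D \<Longrightarrow> (\<And>e. e \<in> E - F \<Longrightarrow> e \<subseteq> D \<or> e \<inter> D = {}) \<Longrightarrow> X \<subseteq> D"
    using cycle_in_component[OF cycle[OF c(1)]] by blast
  obtain Y where Y: "Y \<in> components V (E - F)" "is_cycle Y (induced_edges (E - F) Y) d"
    using cycle_in_component[OF cycle[OF d]] by blast
  have "X \<subseteq> C"
  proof (rule XC)
    show "hd c \<in> C" using c(1) by (cases c) (auto simp: is_cycle_def)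
    show "e \<subseteq> C \<or> e \<inter> C = {}" if "e \<in> E - F" for e
      using that E(2)[of e] by (auto simp: F_def)
  qed
  moreover have "hd d \<in> Y" "hd d \<notin> C"
    using Y(2) d by (cases d; force simp: is_cycle_def)+
  ultimately have "X \<noteq> Y" by blast
  then have "odd_cyclic_edge_cut V E F"
    unfolding odd_cyclic_edge_cut_def cyclic_edge_cut_def using X Y c(2) by (auto simp: F_def)
  then have "lambda_oc V E \<le> enat (card F)" by (auto simp: lambda_oc_def intro: INF_lower)
  also have "card F \<le> arcs E C (V - C)"
    unfolding F_def using E(1) finV assms(2) by (intro card_cut_le_arcs) (auto intro: finite_subset)
  finally show ?thesis by simp
qed

section \<open>The extension theorem\<close>

definition independent :: "'a set set \<Rightarrow> 'a set \<Rightarrow> bool" where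
  "independent E A \<longleftrightarrow> (\<forall>x\<in>A. \<forall>y\<in>A. {x, y} \<notin> E)"

definition bipartition :: "'a set set \<Rightarrow> 'a set \<Rightarrow> 'a set \<Rightarrow> bool" where
  "bipartition E P A \<longleftrightarrow> A \<subseteq> P \<and> independent E A \<and> independent E (P - A)"

lemma bipartition_larger:
  assumes "bipartition E P A"
  obtains A' where "bipartition E P A'" and "card (P - A') \<le> card A'"
proof (cases "card (P - A) \<le> card A")
  case True
  then show ?thesis using assms that by blast
next
  case False
  have "A \<subseteq> P" using assms by (simp add: bipartition_def)
  then have "P - (P - A) = A" by blast
  then show ?thesis using assms False by (intro that[of "P - A"]) (auto simp: bipartition_def)
qed

lemma odd_cycle_if_not_bipartite:
  assumes "simple_graph V E" and "P \<subseteq> V" and "\<nexists>A. bipartition E P A"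
  obtains c where "is_cycle P E c" and "odd (length c)"
proof (rule ccontr)
  assume "\<not> thesis"
  then have no: "\<nexists>c. is_cycle P E c \<and> odd (length c)" using that by blast
  let ?E = "{e \<in> E. e \<subseteq> P}"
  have "finite P" using assms by (auto simp: simple_graph_def intro: finite_subset)
  then have "finite ?E" by (intro finite_subset[of ?E "Pow P"]) auto
  moreover have "\<forall>e\<in>?E. e \<subseteq> P \<and> card e = 2" using assms(1) by (auto simp: simple_graph_def)
  moreover have "\<nexists>c. is_cycle P ?E c \<and> odd (length c)" using no by (auto simp: is_cycle_def)
  ultimately obtain f :: "'a \<Rightarrow> bool" where f: "\<forall>x y. {x, y} \<in> ?E \<longrightarrow> f x \<noteq> f y"
    using two_colourable[of ?E P] by blast
  then have "bipartition E P {x \<in> P. f x}" by (auto simp: bipartition_def independent_def)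
  then show False using assms(3) by blast
qed

lemma arcs_separated:
  assumes "finite V" and "separated (V - U) E S P" and "A \<subseteq> P" and "U \<union> S \<subseteq> V"
  shows "arcs E A V = arcs E A (U \<union> S) + arcs E A P"
    and "arcs E P (V - P) = arcs E P (U \<union> S)"
proof -
  let ?Z = "V - U - S - P"
  have P: "P \<subseteq> V - U - S" and nonadj: "\<And>x y. x \<in> P \<Longrightarrow> y \<in> ?Z \<Longrightarrow> {x, y} \<notin> E"
    using assms(2) by (auto simp: separated_def)
  note fin = finite_subset[OF _ assms(1)]
  have V: "V = (U \<union> S) \<union> (P \<union> ?Z)" "V - P = (U \<union> S) \<union> ?Z" using P assms(4) by auto
  have "arcs E A V = arcs E A (U \<union> S) + (arcs E A P + arcs E A ?Z)"
    using P assms(4)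
    by (subst V(1), subst arcs_Un_right, (auto intro: fin)[3], subst arcs_Un_right)
      (auto intro: fin)
  moreover have "arcs E A ?Z = 0" using nonadj assms(3) by (intro arcs_eq_0) auto
  ultimately show "arcs E A V = arcs E A (U \<union> S) + arcs E A P" by simp
  have "arcs E P (V - P) = arcs E P (U \<union> S) + arcs E P ?Z"
    using P assms(4) by (subst V(2), subst arcs_Un_right) (auto intro: fin)
  moreover have "arcs E P ?Z = 0" using nonadj by (rule arcs_eq_0)
  ultimately show "arcs E P (V - P) = arcs E P (U \<union> S)" by simp
qed

lemma arcs_odd_bipartite:
  assumes "simple_graph V E" and "regular r V E" and sep: "separated (V - U) E S P"
    and US: "U \<union> S \<subseteq> V" and A: "bipartition E P A" and "odd (card P)"
  shows "r \<le> arcs E P (U \<union> S)"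
proof -
  let ?B = "P - A"
  have finV: "finite V" using assms(1) by (simp add: simple_graph_def)
  have PV: "P \<subseteq> V" using sep by (auto simp: separated_def)
  then have finP: "finite P" using finV finite_subset by blast
  have AP: "A \<subseteq> P" and ind: "independent E A" "independent E ?B"
    using A by (auto simp: bipartition_def)
  then have P: "P = A \<union> ?B" and finA: "finite A" using finP finite_subset by auto
  have zero: "arcs E A A = 0" "arcs E ?B ?B = 0"
    using ind by (auto simp: independent_def intro!: arcs_eq_0)
  have split: "arcs E X P = arcs E X A + arcs E X ?B" for X
    using arcs_Un_right[of A ?B E X] P finA finP by simp
  have "r * card A = arcs E A (U \<union> S) + arcs E A ?B"
    using arcs_regular[OF assms(1,2), of A] arcs_separated(1)[OF finV sep AP US] split[of A]
      zero AP PV by simp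
  moreover have "r * card ?B = arcs E ?B (U \<union> S) + arcs E A ?B"
    using arcs_regular[OF assms(1,2), of ?B] arcs_separated(1)[OF finV sep _ US, of ?B]
      split[of ?B] zero PV arcs_commute[of E A ?B] by (simp add: subset_iff)
  moreover have "arcs E P (U \<union> S) = arcs E A (U \<union> S) + arcs E ?B (U \<union> S)"
    using arcs_Un_left[of A ?B E "U \<union> S"] P finA finP by simp
  moreover have "card P = card A + card ?B"
    using card_Un_disjoint[of A ?B] P finA finP by simp
  then have "card A + 1 \<le> card ?B \<or> card ?B + 1 \<le> card A"
    using assms(6) by presburger
  then have "r * card A + r \<le> r * card ?B \<or> r * card ?B + r \<le> r * card A"
    by (metis mult_le_mono2 distrib_left mult.right_neutral)
  ultimately show ?thesis by linarith
qed

lemma card_matching_vertices: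
  assumes "simple_graph V E" and "matching E M"
  shows "finite M" and "\<Union>M \<subseteq> V" and "card (\<Union>M) = 2 * card M"
proof -
  have M: "\<And>e. e \<in> M \<Longrightarrow> e \<subseteq> V \<and> card e = 2" and "pairwise disjnt M" and "finite V"
    using assms by (auto simp: simple_graph_def matching_def)
  then show "\<Union>M \<subseteq> V" by blast
  show "finite M" using M \<open>finite V\<close> by (intro finite_subset[of M "Pow V"]) auto
  have "card (\<Union>M) = sum card M"
    using M \<open>finite V\<close> \<open>pairwise disjnt M\<close>
    by (intro card_Union_disjoint) (auto intro: finite_subset)
  then show "card (\<Union>M) = 2 * card M" using M by simp
qed

lemma arcs_to_matching_le_1:
  assumes "simple_graph V E" and "distance_matching 3 V E M" and v: "v \<in> V - \<Union>M"
    and Y: "insert v (\<Union>M) \<subseteq> Y" and acyclic: "\<nexists>c. is_cycle Y E c"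
  shows "arcs E {v} (\<Union>M) \<le> 1"
proof (rule ccontr)
  let ?N = "{y \<in> \<Union>M. {v, y} \<in> E}"
  have M: "matching E M" using assms(2) by (simp add: distance_matching_def)
  note MV = card_matching_vertices[OF assms(1) M]
  have finU: "finite (\<Union>M)" using MV assms(1) by (auto simp: simple_graph_def intro: finite_subset)
  assume "\<not> arcs E {v} (\<Union>M) \<le> 1"
  then have "\<not> card ?N \<le> Suc 0" using arcs_singleton[OF finU, of E v] by simp
  moreover have "finite ?N" by (rule finite_subset[OF _ finU]) blast
  ultimately obtain y z where "y \<in> ?N" "z \<in> ?N" "y \<noteq> z"
    by (meson card_le_Suc0_iff_eq)
  obtain e f where e: "e \<in> M" "y \<in> e" "{v, y} \<in> E" and f: "f \<in> M" "z \<in> f" "{v, z} \<in> E"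
    using \<open>y \<in> ?N\<close> \<open>z \<in> ?N\<close> by blast
  have vyz: "v \<noteq> y" "v \<noteq> z" using v e f by blast+
  show False
  proof (cases "e = f")
    case True
    have "e \<in> E" using M e(1) by (auto simp: matching_def)
    then have "card e = 2" using assms(1) by (auto simp: simple_graph_def)
    then obtain a b where "e = {a, b}" unfolding card_2_iff by blast
    then have "e = {y, z}" using e f True \<open>y \<noteq> z\<close> by auto
    then have "is_cycle Y E [v, y, z]"
      using \<open>e \<in> E\<close> e f vyz \<open>y \<noteq> z\<close> Y
      by (auto simp: is_cycle_def cycle_edges_def insert_commute)
    then show False using acyclic by blast
  next
    case False
    have "is_path V E [y, v, z]"
      using e f vyz \<open>y \<noteq> z\<close> v MV(2) by (auto simp: is_path_def insert_commute)
    then have "edge_dist V E e f \<le> enat (length [y, v, z] - 1)"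
      unfolding edge_dist_def using e f by (intro INF_lower) auto
    also have "\<dots> = enat 2" by simp
    finally have "enat 3 \<le> enat 2"
      using assms(2) e f False by (meson distance_matching_def order_trans)
    then show False by simp
  qed
qed

lemma cycle_on_odd_parts:
  assumes G: "simple_graph V E" "regular r V E" and "3 \<le> r" and M: "distance_matching 3 V E M"
    and \<P>: "odd_parts (V - \<Union>M) E S \<P>" and less: "card S < card \<P>"
    and Y: "\<Union>M \<union> S \<union> \<Union>\<P> \<subseteq> Y" "Y \<subseteq> V"
  shows "\<exists>c. is_cycle Y E c"
proof (rule ccontr)
  assume acyclic: "\<nexists>c. is_cycle Y E c"
  let ?U = "\<Union>M" and ?W = "\<Union>\<P>"
  have finV: "finite V" and E: "\<forall>e\<in>E. card e = 2" using G(1) by (auto simp: simple_graph_def)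
  note fin = finite_subset[OF _ finV]
  note fin\<P> = odd_parts_finite[OF _ \<P>]
  have part: "\<And>P. P \<in> \<P> \<Longrightarrow> separated (V - ?U) E S P" "\<And>P. P \<in> \<P> \<Longrightarrow> odd (card P)"
    and disj: "pairwise disjnt \<P>" and S: "S \<subseteq> V - ?U"
    using \<P> by (auto simp: odd_parts_def)
  have W: "?W \<subseteq> V - ?U - S" using part by (auto simp: separated_def)
  have finP: "finite P" if "P \<in> \<P>" for P using fin\<P> finV that by blast
  have finite: "finite \<P>" "finite S" "finite ?W" "finite ?U"
    using fin\<P>(1,3) finV Y fin[of ?W] fin[of ?U] by auto
  have forest: "arcs E X X + 2 \<le> 2 * card X" if "X \<subseteq> Y" "X \<noteq> {}" for X
  proof (rule arcs_acyclic)
    show "finite X" using that(1) Y(2) by (intro fin) blast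
    show "\<nexists>c. is_cycle X E c" using acyclic that(1) by (auto simp: is_cycle_def)
  qed fact+
  have sum: "arcs E ?W X = (\<Sum>P\<in>\<P>. arcs E P X)" for X
    using finP disj by (rule arcs_Union_left)
  define inner where "inner = (\<Sum>P\<in>\<P>. arcs E P P)"
  have "inner \<le> arcs E ?W ?W"
    unfolding inner_def sum using finite by (intro sum_mono arcs_mono_right) auto
  have nonempty: "P \<noteq> {}" if "P \<in> \<P>" for P using part(2)[OF that] by auto
  have "r * card ?W = arcs E ?W V" using G W by (intro arcs_regular[symmetric]) auto
  also have "\<dots> = (\<Sum>P\<in>\<P>. arcs E P (?U \<union> S) + arcs E P P)"
    unfolding sum using part S Y finV by (intro sum.cong arcs_separated) auto
  also have "\<dots> = arcs E ?W (?U \<union> S) + inner"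
    by (simp add: sum.distrib sum inner_def)
  also have "arcs E ?W (?U \<union> S) = arcs E ?W ?U + arcs E ?W S"
    using finite S by (intro arcs_Un_right) auto
  finally have total: "r * card ?W = arcs E ?W ?U + arcs E ?W S + inner" .
  have "arcs E ?W ?U \<le> (\<Sum>v\<in>?W. 1)"
    unfolding arcs_eq_sum[of E ?W] using W Y acyclic
    by (intro sum_mono arcs_to_matching_le_1[OF G(1) M]) auto
  then have toU: "arcs E ?W ?U \<le> card ?W" by simp
  have "(\<Sum>P\<in>\<P>. arcs E P P + 2) \<le> (\<Sum>P\<in>\<P>. 2 * card P)"
    using nonempty Y by (intro sum_mono forest) auto
  moreover have "card ?W = (\<Sum>P\<in>\<P>. card P)"
    using disj finP by (intro card_Union_disjoint) auto
  ultimately have parts: "inner + 2 * card \<P> \<le> 2 * card ?W"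
    unfolding inner_def sum_distrib_left[symmetric] sum.distrib by simp
  obtain P where "P \<in> \<P>" using less by fastforce
  then have "?W \<noteq> {}" using nonempty by blast
  then have "arcs E (?W \<union> S) (?W \<union> S) + 2 \<le> 2 * card (?W \<union> S)"
    using Y by (intro forest) auto
  moreover have "card (?W \<union> S) = card ?W + card S"
    using finite W by (intro card_Un_disjoint) auto
  moreover have "arcs E (?W \<union> S) (?W \<union> S) = arcs E ?W ?W + arcs E ?W S + (arcs E S ?W + arcs E S S)"
  proof -
    have "?W \<inter> S = {}" using W by blast
    then show ?thesis using finite by (simp add: arcs_Un_left arcs_Un_right)
  qed
  ultimately have "inner + 2 * arcs E ?W S + 2 \<le> 2 * card ?W + 2 * card S"
    using \<open>inner \<le> _\<close> arcs_commute[of E S ?W] by linarith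
  then have "arcs E ?W S + inner + 2 \<le> 2 * card ?W" using parts less by linarith
  then have "r * card ?W < 3 * card ?W" using total toU by linarith
  then show False using \<open>3 \<le> r\<close> by simp
qed

lemma odd_ear_edge:
  assumes "simple_graph V E" and "independent E W" and "U \<subseteq> V - W" and "is_odd_ear V E U A"
  shows "\<exists>e\<in>A. e \<in> E \<and> e \<subseteq> V - W"
proof (rule ccontr)
  assume no: "\<not> ?thesis"
  have AE: "A \<subseteq> E"
    using assms(4) by (auto simp: is_odd_ear_def is_ear_def is_path_def is_cycle_def)
  have alt: "(x \<in> W) \<noteq> (y \<in> W)" if "{x, y} \<in> A" for x y
  proof -
    have "{x, y} \<in> E" using AE that by blast
    moreover from this have "{x, y} \<subseteq> V" using assms(1) unfolding simple_graph_def by blast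
    ultimately show ?thesis using no that assms(2) by (auto simp: independent_def)
  qed
  have "odd (card A)" "is_ear V E U A" using assms(4) by (auto simp: is_odd_ear_def)
  from this(2) show False unfolding is_ear_def
  proof (elim disjE exE conjE)
    fix p assume p: "is_path V E p" "hd p \<in> U" "last p \<in> U" "A = path_edges p"
    then have "odd (length p)"
      using path_alternates[of p "\<lambda>x. x \<in> W"] alt assms(3) by (auto simp: is_path_def)
    moreover have "card A = length p - 1"
      using p card_path_edges by (auto simp: is_path_def)
    ultimately show False using \<open>odd (card A)\<close> by simp
  next
    fix c assume c: "is_cycle V E c" "A = cycle_edges c"
    have "c \<noteq> []" using c(1) by (auto simp: is_cycle_def)
    then have "(hd c \<in> W) = (last c \<in> W) \<longleftrightarrow> odd (length c)"
      using alt c(2) by (intro path_alternates) (auto simp: cycle_edges_def)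
    moreover have "(last c \<in> W) \<noteq> (hd c \<in> W)" using c(2) by (intro alt) (simp add: cycle_edges_def)
    ultimately have "even (length c)" by auto
    moreover have "card A = length c"
      using c card_cycle_edges by (auto simp: is_cycle_def)
    ultimately show False using \<open>odd (card A)\<close> by simp
  qed
qed

theorem theorem5:
  fixes V :: "'a set" and E M :: "'a set set" and m r :: nat
  assumes "3 \<le> r" and "r \<le> m"
    and "simple_graph V E"
    and "regular r V E"
    and "even (card V)"
    and "enat ((2 * m - 1) * (r - 1)) \<le> lambda_oc V E"
    and "distance_matching 3 V E M"
    and "card M = m"
    and "\<exists>\<A>. card \<A> = m * r - r + 1 \<and> (\<forall>A\<in>\<A>. is_odd_ear V E (\<Union>M) A) \<and> pairwise disjnt \<A>"
  shows "extends_to_perfect_matching V E M"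
proof (rule ccontr)
  assume not_ext: "\<not> extends_to_perfect_matching V E M"
  let ?U = "\<Union>M" and ?K = "(2 * m - 1) * (r - 1)"
  note G = assms(3,4)
  have finV: "finite V" and E: "\<forall>e\<in>E. card e = 2" using G(1) by (auto simp: simple_graph_def)
  note fin = finite_subset[OF _ finV]
  have M: "matching E M" using assms(7) by (simp add: distance_matching_def)
  note MV = card_matching_vertices[OF G(1) M]
  have cardU: "card ?U = 2 * m" using MV(3) assms(8) by simp
  have "\<nexists>M'. perfect_matching (V - ?U) E M'"
  proof
    assume "\<exists>M'. perfect_matching (V - ?U) E M'"
    then obtain M' where M': "M' \<subseteq> E" "pairwise disjnt M'" "\<Union>M' = V - ?U"
      by (auto simp: perfect_matching_def matching_def)
    have "disjnt a b" "disjnt b a" if "a \<in> M" "b \<in> M'" for a b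
      using M'(3) that by (auto simp: disjnt_def)
    moreover have "pairwise disjnt M" using M by (simp add: matching_def)
    ultimately have "pairwise disjnt (M \<union> M')"
      using M'(2) unfolding pairwise_def by (metis UnE)
    moreover have "\<Union>(M \<union> M') = V" using M'(3) MV(2) by auto
    moreover have "M \<union> M' \<subseteq> E" using M M'(1) by (auto simp: matching_def)
    ultimately have "perfect_matching V E (M \<union> M')"
      by (simp add: perfect_matching_def matching_def)
    then show False using not_ext by (auto simp: extends_to_perfect_matching_def)
  qed
  then obtain S \<P>' where \<P>': "odd_parts (V - ?U) E S \<P>'" "card S < card \<P>'"
    using tutte[of "V - ?U" E] finV by (meson finite_Diff not_less)
  have evX: "even (card (V - ?U))"
    using card_Diff_subset[of ?U V] MV(2) cardU assms(5) fin card_mono[OF finV MV(2)] by simp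
  obtain \<P> where \<P>: "odd_parts (V - ?U) E S \<P>" and k: "card S + 2 \<le> card \<P>"
    using odd_parts_even_improve[OF _ evX \<P>'] finV by blast
  define R where "R = V - ?U - S - \<Union>\<P>"
  have disj: "pairwise disjnt \<P>" and S: "S \<subseteq> V - ?U"
    and odd_part: "\<And>P. P \<in> \<P> \<Longrightarrow> odd (card P)"
    using \<P> by (auto simp: odd_parts_def)
  have sep: "separated (V - ?U) E S C" if "C \<in> insert R \<P>" for C
    using that \<P> separated_rest[of \<P> "V - ?U" E S] by (auto simp: odd_parts_def R_def)
  have sub: "C \<subseteq> V - ?U - S" if "C \<in> insert R \<P>" for C
    using sep[OF that] by (auto simp: separated_def)
  have disjI: "C \<inter> D = {}" if "C \<in> insert R \<P>" "D \<in> insert R \<P>" "C \<noteq> D" for C D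
    using that disj by (auto simp: R_def pairwise_def disjnt_def)
  have fin\<P>: "finite \<P>" using odd_parts_finite[OF _ \<P>] finV by blast
  have US: "?U \<union> S \<subseteq> V" using MV(2) S by blast
  have finU: "finite ?U" and finS: "finite S" and finUS: "finite (?U \<union> S)"
    using US fin[of ?U] fin[of S] by simp_all
  have "r \<le> ?K"
  proof -
    have "2 * (r - 1) \<le> ?K" using assms(1,2) by (intro mult_le_mono1) linarith
    then show ?thesis using assms(1) by linarith
  qed
  have big: "?K \<le> arcs E C (?U \<union> S)" if C: "C \<in> insert R \<P>" and nonbip: "\<nexists>A. bipartition E C A" for C
  proof -
    have CV: "C \<subseteq> V" using sub[OF C] by blast
    obtain c where c: "is_cycle C E c" "odd (length c)"
      using odd_cycle_if_not_bipartite[OF G(1) CV nonbip] by blast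
    have "odd_parts (V - ?U) E S (\<P> - {C})"
      using \<P> by (auto simp: odd_parts_def pairwise_def)
    moreover have "card S < card (\<P> - {C})"
      using k by (simp add: card_Diff_singleton_if) linarith
    moreover have "?U \<union> S \<union> \<Union>(\<P> - {C}) \<subseteq> V - C"
    proof -
      have "P \<subseteq> V - C" if "P \<in> \<P> - {C}" for P
        using sub[of P] disjI[OF C, of P] that by blast
      moreover have "?U \<union> S \<subseteq> V - C" using US sub[OF C] by blast
      ultimately show ?thesis by blast
    qed
    ultimately obtain d where "is_cycle (V - C) E d"
      using cycle_on_odd_parts[OF G assms(1,7)] by blast
    then have "lambda_oc V E \<le> enat (arcs E C (V - C))"
      using lambda_oc_le_arcs[OF G(1) CV c] by blast
    then have "enat ?K \<le> enat (arcs E C (V - C))" using assms(6) by (rule order_trans[rotated])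
    then show ?thesis
      using arcs_separated(2)[OF finV sep[OF C] order.refl US] by simp
  qed
  have part_arcs: "r \<le> arcs E P (?U \<union> S)" if P: "P \<in> \<P>" for P
  proof (cases "\<exists>A. bipartition E P A")
    case True
    then obtain A where "bipartition E P A" by blast
    then show ?thesis using P by (intro arcs_odd_bipartite[OF G sep US _ odd_part]) auto
  next
    case False
    then show ?thesis using big[of P] \<open>r \<le> ?K\<close> P by (meson insertI2 order_trans)
  qed
  have upper: "arcs E (V - (?U \<union> S)) (?U \<union> S) \<le> r * card S + 2 * m * (r - 1)"
  proof -
    have "finite {e \<in> E. e \<subseteq> ?U}"
      by (rule finite_subset[of _ "Pow ?U"]) (use finU in auto)
    then have "card M \<le> card {e \<in> E. e \<subseteq> ?U}"
      by (rule card_mono) (use M in \<open>auto simp: matching_def\<close>)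
    then have "2 * m \<le> arcs E ?U ?U" using arcs_within[OF E finU] assms(8) by simp
    also have "\<dots> \<le> arcs E (?U \<union> S) ?U" using finUS by (intro arcs_mono_left) auto
    also have "\<dots> \<le> arcs E (?U \<union> S) (?U \<union> S)" using finUS by (intro arcs_mono_right) auto
    finally have inner: "2 * m \<le> arcs E (?U \<union> S) (?U \<union> S)" .
    have "?U \<inter> S = {}" using S by blast
    then have "card (?U \<union> S) = 2 * m + card S"
      using card_Un_disjoint[OF finU finS] cardU by simp
    then have "r * (2 * m + card S) = arcs E (?U \<union> S) V"
      using arcs_regular[OF G US] by simp
    also have "\<dots> = arcs E (?U \<union> S) (?U \<union> S) + arcs E (?U \<union> S) (V - (?U \<union> S))"
    proof -
      have "V = (?U \<union> S) \<union> (V - (?U \<union> S))" using US by blast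
      then show ?thesis
        using arcs_Un_right[OF finUS, of "V - (?U \<union> S)" E "?U \<union> S"] finV by auto
    qed
    finally have "arcs E (V - (?U \<union> S)) (?U \<union> S) + 2 * m \<le> r * (2 * m + card S)"
      using inner arcs_commute[of E "?U \<union> S" "V - (?U \<union> S)"] by linarith
    moreover have "2 * m * (r - 1) + 2 * m = 2 * m * r" using assms(1) by (cases r) auto
    ultimately show ?thesis by (simp add: algebra_simps)
  qed
  have bip: "\<exists>A. bipartition E C A \<and> card (C - A) \<le> card A" if C: "C \<in> insert R \<P>" for C
  proof (cases "\<exists>A. bipartition E C A")
    case True
    then show ?thesis by (meson bipartition_larger)
  next
    case False
    let ?Q = "\<P> - {C}"
    have finQ: "finite P" if "P \<in> ?Q" for P using sub[of P] that fin by blast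
    have "r * (card S + 1) \<le> r * card ?Q"
      using k by (intro mult_le_mono2) (simp add: card_Diff_singleton_if, linarith)
    also have "\<dots> = (\<Sum>P\<in>?Q. r)" by simp
    also have "\<dots> \<le> (\<Sum>P\<in>?Q. arcs E P (?U \<union> S))" using part_arcs by (intro sum_mono) auto
    also have "\<dots> = arcs E (\<Union>?Q) (?U \<union> S)"
      using finQ disj by (intro arcs_Union_left[symmetric]) (auto simp: pairwise_def)
    finally have "r * (card S + 1) + ?K \<le> arcs E (\<Union>?Q) (?U \<union> S) + arcs E C (?U \<union> S)"
      using big[OF C False] by linarith
    also have "\<dots> = arcs E (\<Union>?Q \<union> C) (?U \<union> S)"
    proof (rule arcs_Un_left[symmetric])
      show "finite (\<Union>?Q)" using finQ fin\<P> by blast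
      show "finite C" using sub[OF C] by (intro fin) blast
      show "\<Union>?Q \<inter> C = {}" using disjI[OF C] by blast
    qed
    also have "\<dots> \<le> arcs E (V - (?U \<union> S)) (?U \<union> S)"
    proof (rule arcs_mono_left)
      have "P \<subseteq> V - (?U \<union> S)" if "P \<in> insert R \<P>" for P using sub[OF that] by blast
      then show "\<Union>?Q \<union> C \<subseteq> V - (?U \<union> S)" using C by blast
    qed (use finV in simp)
    also note upper
    finally have "r + ?K \<le> 2 * m * (r - 1)" by simp
    moreover have "?K + (r - 1) = 2 * m * (r - 1)" using assms(1,2) by (cases m) auto
    ultimately show ?thesis using assms(1) by linarith
  qed
  then obtain A where A: "\<And>C. C \<in> insert R \<P> \<Longrightarrow> bipartition E C (A C)"
    and larger: "\<And>C. C \<in> insert R \<P> \<Longrightarrow> card (C - A C) \<le> card (A C)" by metis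
  have AC: "A C \<subseteq> C" if "C \<in> insert R \<P>" for C using A[OF that] by (simp add: bipartition_def)
  define W W' where "W = (\<Union>C\<in>insert R \<P>. A C)" and "W' = (\<Union>C\<in>insert R \<P>. C - A C)"
  have WV: "W \<subseteq> V - ?U - S" unfolding W_def
    by (rule UN_least) (rule order_trans[OF AC sub])
  have indW: "independent E W"
    unfolding independent_def
  proof (intro ballI)
    fix x y assume "x \<in> W" "y \<in> W"
    then obtain C D where C: "C \<in> insert R \<P>" "x \<in> A C" and D: "D \<in> insert R \<P>" "y \<in> A D"
      unfolding W_def by blast
    show "{x, y} \<notin> E"
    proof (cases "C = D")
      case True
      then show ?thesis using A[OF C(1)] C D by (auto simp: bipartition_def independent_def)
    next
      case False
      then have "y \<in> V - ?U - S - C"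
        using disjI[OF C(1) D(1)] subsetD[OF AC[OF D(1)] D(2)] sub[OF D(1)] by blast
      moreover have "x \<in> C" using AC[OF C(1)] C by blast
      ultimately show ?thesis using sep[OF C(1)] unfolding separated_def by blast
    qed
  qed
  have "R \<notin> \<P>"
  proof
    assume *: "R \<in> \<P>"
    then have "R = {}" by (auto simp: R_def)
    then show False using odd_part[OF *] by simp
  qed
  have cardUN: "card (\<Union>C\<in>insert R \<P>. f C) = card (f R) + (\<Sum>C\<in>\<P>. card (f C))"
    if f: "\<And>C. C \<in> insert R \<P> \<Longrightarrow> f C \<subseteq> C" for f
  proof -
    have "card (\<Union>C\<in>insert R \<P>. f C) = (\<Sum>C\<in>insert R \<P>. card (f C))"
    proof (rule card_UN_disjoint)
      show "\<forall>C\<in>insert R \<P>. finite (f C)"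
      proof
        fix C assume C: "C \<in> insert R \<P>"
        show "finite (f C)" using f[OF C] sub[OF C] by (intro fin) blast
      qed
      show "\<forall>C\<in>insert R \<P>. \<forall>D\<in>insert R \<P>. C \<noteq> D \<longrightarrow> f C \<inter> f D = {}"
      proof (intro ballI impI)
        fix C D assume CD: "C \<in> insert R \<P>" "D \<in> insert R \<P>" "C \<noteq> D"
        show "f C \<inter> f D = {}" using f[OF CD(1)] f[OF CD(2)] disjI[OF CD] by blast
      qed
    qed (use fin\<P> in simp)
    then show ?thesis using fin\<P> \<open>R \<notin> \<P>\<close> by simp
  qed
  have "card W' + card \<P> = card (R - A R) + (\<Sum>C\<in>\<P>. card (C - A C) + 1)"
    unfolding W'_def sum.distrib using cardUN[of "\<lambda>C. C - A C"] by simp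
  also have "\<dots> \<le> card (A R) + (\<Sum>C\<in>\<P>. card (A C))"
  proof (intro add_mono sum_mono)
    show "card (R - A R) \<le> card (A R)" using larger by simp
    fix C assume C: "C \<in> \<P>"
    then have "A C \<subseteq> C" "C \<subseteq> V" using AC[of C] sub[of C] by auto
    then have "card C = card (A C) + card (C - A C)"
      using fin[of C] by (simp add: card_Diff_subset card_mono finite_subset)
    then show "card (C - A C) + 1 \<le> card (A C)"
      using larger[of C] odd_part[OF C] C by (cases "card (C - A C) = card (A C)") auto
  qed
  also have "\<dots> = card W" unfolding W_def using AC by (rule cardUN[symmetric])
  finally have cardW: "card W' + card \<P> \<le> card W" .
  define B where "B = V - W"
  have B: "B = ?U \<union> S \<union> W'"
  proof
    show "B \<subseteq> ?U \<union> S \<union> W'"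
    proof
      fix x assume x: "x \<in> B"
      show "x \<in> ?U \<union> S \<union> W'"
      proof (cases "x \<in> ?U \<union> S")
        case False
        then obtain C where C: "C \<in> insert R \<P>" "x \<in> C" using x by (auto simp: B_def R_def)
        moreover have "x \<notin> A C" using x C(1) by (auto simp: B_def W_def)
        ultimately show ?thesis by (auto simp: W'_def)
      qed simp
    qed
    have "(C - A C) \<inter> A D = {}" if "C \<in> insert R \<P>" "D \<in> insert R \<P>" for C D
      using disjI[OF that] AC[OF that(2)] by (cases "C = D") auto
    then have "W' \<inter> W = {}" unfolding W_def W'_def by blast
    moreover have "C \<subseteq> V" if "C \<in> insert R \<P>" for C using sub[OF that] by blast
    then have "W' \<subseteq> V" unfolding W'_def by blast
    ultimately show "?U \<union> S \<union> W' \<subseteq> B" unfolding B_def using US WV by blast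
  qed
  have finW: "finite W" and finB: "finite B" and V: "V = W \<union> B" "W \<inter> B = {}"
    using WV fin[of W] finV by (auto simp: B_def)
  have "card B \<le> card ?U + card S + card W'"
    using card_Un_le[of ?U S] card_Un_le[of "?U \<union> S" W'] unfolding B by linarith
  then have "card B + 2 \<le> 2 * m + card W" using cardU cardW k by linarith
  then have "r * (card B + 2) \<le> r * (2 * m + card W)" by (rule mult_le_mono2)
  moreover have "r * card W = arcs E W B"
  proof -
    have "r * card W = arcs E W V" using arcs_regular[OF G, of W] V(1) by simp
    also have "\<dots> = arcs E W W + arcs E W B"
      using arcs_Un_right[OF finW finB V(2)] V(1) by simp
    also have "arcs E W W = 0" using indW by (auto simp: independent_def intro: arcs_eq_0)
    finally show ?thesis by simp
  qed
  moreover have "r * card B = arcs E W B + arcs E B B"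
  proof -
    have "r * card B = arcs E B V" using arcs_regular[OF G, of B] V(1) by simp
    also have "\<dots> = arcs E B W + arcs E B B"
      using arcs_Un_right[OF finW finB V(2)] V(1) by simp
    finally show ?thesis by (simp add: arcs_commute)
  qed
  ultimately have "arcs E B B + r * 2 \<le> r * 2 * m" by (simp add: algebra_simps)
  then have edges: "card {e \<in> E. e \<subseteq> B} + r \<le> m * r"
    using arcs_within[OF E finB] by (simp add: algebra_simps)
  obtain \<A> where \<A>: "card \<A> = m * r - r + 1" "\<And>X. X \<in> \<A> \<Longrightarrow> is_odd_ear V E ?U X"
    "pairwise disjnt \<A>" using assms(9) by blast
  have "\<forall>X\<in>\<A>. \<exists>e\<in>X. e \<in> E \<and> e \<subseteq> B"
  proof
    fix X assume "X \<in> \<A>"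
    moreover have "?U \<subseteq> V - W" using WV MV(2) by blast
    ultimately show "\<exists>e\<in>X. e \<in> E \<and> e \<subseteq> B"
      using odd_ear_edge[OF G(1) indW _ \<A>(2)] unfolding B_def by blast
  qed
  then obtain g where g: "\<And>X. X \<in> \<A> \<Longrightarrow> g X \<in> X" "\<And>X. X \<in> \<A> \<Longrightarrow> g X \<in> {e \<in> E. e \<subseteq> B}"
    by (metis (mono_tags, lifting) mem_Collect_eq)
  have "inj_on g \<A>"
    using g(1) \<A>(3) unfolding inj_on_def pairwise_def disjnt_iff by metis
  moreover have "finite {e \<in> E. e \<subseteq> B}"
    by (rule finite_subset[of _ "Pow B"]) (use finB in auto)
  ultimately have "card \<A> \<le> card {e \<in> E. e \<subseteq> B}"
    using g(2) by (intro card_inj_on_le) auto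
  then show False using \<A>(1) edges by linarith
qed

end
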